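(* Let $(\overline{x},\overline{y})$ be a feasible solution to the Benders master problem (BMP). Let $\hat h,\hat k\in H$ be an arbitrary pair of hubs for which the flow-capacity condition is violated, i.e. $$\sum_{i\in N}\overline{x}_{\hat h i}\sum_{j\in N} w_{ij}\,\overline{x}_{\hat k j} > Q_{\hat h\hat k}\,\overline{y}_{\hat h\hat k}.$$ Then, given a constant $\Gamma>0$, the vector $(\overline{\lambda},\overline{\mu},\overline{\nu})\in\mathbb{R}^{H\times H}\times\mathbb{R}^{H\times N}\times\mathbb{R}^{H\times N}$ defined by $$\overline{\lambda}_{hk}=\begin{cases}-\Gamma & \text{if } h=\hat h \text{ and } k=\hat k,\\ 0 & \text{otherwise},\end{cases}\qquad h,k\in H,$$ $$\overline{\mu}_{hi}=\sum_{h'\in H}\sum_{k\in H}\overline{\lambda}_{h'k}\,\overline{x}_{h'i}-\sum_{k\in H}\overline{\lambda}_{hk}\,\overline{x}_{hi},\qquad h\in H,\ i\in N,$$ $$\overline{\nu}_{ki}=-\sum_{h\in H}\overline{\lambda}_{hk}\,\overline{x}_{hi},\qquad k\in H,\ i\in N,$$ is an unbounded ray for $\mathrm{DSP}(\overline{x},\overline{y})$.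
   Context: Data. $N$ is a finite set of demand nodes and $H\subset N$ a set of candidate hubs. For $i,j\in N$, $w_{ij}\ge 0$ is the flow from $i$ to $j$, and $O_i=\sum_{j\in N}w_{ij}$. For $h,k\in H$, $Q_{hk}>0$ is the capacity of a primary (inter-hub) vehicle on arc $(h,k)$. Feasible assignments and vehicle numbers. $\mathcal{X}$ is the set of binary vectors $x=(x_{hi})_{h\in H,i\in N}\in\{0,1\}^{H\times N}$ satisfying $\sum_{h\in H}x_{hi}=1$ for all $i\in N$ and $x_{hi}\le x_{hh}$ for all $h\in H$, $i\in N$. (Depending on the problem variant, $\mathcal{X}$ may additionally include $\sum_{h\in H}x_{hh}=p$ and/or hub capacity constraints $\sum_{i\in N}O_i x_{hi}\le U_h x_{hh}$ for $h\in H$.) $\mathcal{Y}=\mathbb{Z}_{\ge 0}^{H\times H}$ is the set of vectors $y=(y_{hk})_{h,k\in H}$ of nonnegative integers. Dual subproblem. For $(\overline{x},\overline{y})\in\mathcal{X}\times\mathcal{Y}$, $\mathrm{DSP}(\overline{x},\overline{y})$ is the linear program in variables $\lambda\in\mathbb{R}_{\le 0}^{H\times H}$, $\mu,\nu\in\mathbb{R}^{H\times N}$: $$\max\ \sum_{h\in H}\sum_{k\in H}Q_{hk}\overline{y}_{hk}\lambda_{hk}+\sum_{h\in H}\sum_{i\in N}\Bigl(O_i\overline{x}_{hi}\mu_{hi}+\sum_{j\in N}w_{ij}\overline{x}_{hj}\nu_{hi}\Bigr)$$ $$\text{s.t.}\quad \lambda_{hk}+\mu_{hi}+\nu_{ki}\le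 0\qquad\text{for all }h,k\in H,\ i\in N.$$ It is the dual of the feasibility problem (minimize $0$) of finding $z\in\mathbb{R}_{\ge0}^{N\times H\times H}$ with $\sum_{i\in N}z_{ihk}\le Q_{hk}\overline{y}_{hk}$ for $h,k\in H$; $\sum_{k\in H}z_{ihk}=O_i\overline{x}_{hi}$ for $h\in H,i\in N$; and $\sum_{h\in H}z_{ihk}=\sum_{j\in N}w_{ij}\overline{x}_{kj}$ for $k\in H,i\in N$. The feasible set of $\mathrm{DSP}$ is a polyhedral cone (all constraints are homogeneous). An unbounded ray for $\mathrm{DSP}(\overline{x},\overline{y})$ is a vector in this cone (so $\lambda\le 0$ and all the inequality constraints hold) at which the objective value is strictly positive, so that the objective is unbounded above along its nonnegative multiples. Master problem. The Benders master problem (BMP) minimizes a cost function of $(x,y)$ over $x\in\mathcal{X}$, $y\in\mathcal{Y}$ subject to the feasibility cuts generated so far, a (possibly empty) finite family of inequalities $$\sum_{h\in H}\sum_{k\in H}Q_{hk}\lambda^r_{hk}y_{hk}+\sum_{h\in H}\sum_{i\in N}\Bigl(O_i\mu^r_{hi}x_{hi}+\sum_{j\in N}w_{ij}\nu^r_{hi}x_{hj}\Bigr)\le 0,$$ where each $(\lambda^r,\mu^r,\nu^r)$ belongs to the feasible cone of $\mathrm{DSP}$. In particular, a feasible solution $(\overline{x},\overline{y})$ of BMP has $\overline{x}\in\mathcal{X}$ and $\overline{y}\in\mathcal{Y}$. *)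

theory Defs
  imports Complex_Main
begin

(* A vector indexed by H x H or H x N (with H a subset of N) is a function of two arguments;
   only its values on the index set matter, and every sum and quantifier below is relativised
   accordingly. The component names follow the order of the subscripts: x h i, y h k, w i j. *)
type_synonym 'a vec2 = "'a \<Rightarrow> 'a \<Rightarrow> real"

definition out_flow :: "'a set \<Rightarrow> 'a vec2 \<Rightarrow> 'a \<Rightarrow> real" where
  "out_flow N w i = (\<Sum>j\<in>N. w i j)"

(* The optional constraints of the problem variants: p = None leaves out the cardinality
   constraint, U = None leaves out the hub capacity constraints. *)
definition assignments ::
  "'a set \<Rightarrow> 'a set \<Rightarrow> 'a vec2 \<Rightarrow> nat option \<Rightarrow> ('a \<Rightarrow> real) option \<Rightarrow> 'a vec2 set" where
  "assignments N H w p U = {x.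
     (\<forall>h\<in>H. \<forall>i\<in>N. x h i \<in> {0, 1}) \<and>
     (\<forall>i\<in>N. (\<Sum>h\<in>H. x h i) = 1) \<and>
     (\<forall>h\<in>H. \<forall>i\<in>N. x h i \<le> x h h) \<and>
     (case p of None \<Rightarrow> True | Some q \<Rightarrow> (\<Sum>h\<in>H. x h h) = real q) \<and>
     (case U of None \<Rightarrow> True
        | Some u \<Rightarrow> (\<forall>h\<in>H. (\<Sum>i\<in>N. out_flow N w i * x h i) \<le> u h * x h h))}"

definition vehicle_numbers :: "'a set \<Rightarrow> 'a vec2 set" where
  "vehicle_numbers H = {y. \<forall>h\<in>H. \<forall>k\<in>H. y h k \<in> \<nat>}"

definition dsp_cone :: "'a set \<Rightarrow> 'a set \<Rightarrow> ('a vec2 \<times> 'a vec2 \<times> 'a vec2) set" where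
  "dsp_cone N H = {(lam, mu, nu).
     (\<forall>h\<in>H. \<forall>k\<in>H. lam h k \<le> 0) \<and>
     (\<forall>h\<in>H. \<forall>k\<in>H. \<forall>i\<in>N. lam h k + mu h i + nu k i \<le> 0)}"

definition dsp_objective ::
  "'a set \<Rightarrow> 'a set \<Rightarrow> 'a vec2 \<Rightarrow> 'a vec2 \<Rightarrow> 'a vec2 \<Rightarrow> 'a vec2 \<Rightarrow>
   'a vec2 \<times> 'a vec2 \<times> 'a vec2 \<Rightarrow> real" where
  "dsp_objective N H w Q x y = (\<lambda>(lam, mu, nu).
     (\<Sum>h\<in>H. \<Sum>k\<in>H. Q h k * y h k * lam h k) +
     (\<Sum>h\<in>H. \<Sum>i\<in>N. out_flow N w i * x h i * mu h i + (\<Sum>j\<in>N. w i j * x h j * nu h i)))"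

definition dsp_unbounded_ray ::
  "'a set \<Rightarrow> 'a set \<Rightarrow> 'a vec2 \<Rightarrow> 'a vec2 \<Rightarrow> 'a vec2 \<Rightarrow> 'a vec2 \<Rightarrow>
   'a vec2 \<times> 'a vec2 \<times> 'a vec2 \<Rightarrow> bool" where
  "dsp_unbounded_ray N H w Q x y r \<longleftrightarrow> r \<in> dsp_cone N H \<and> dsp_objective N H w Q x y r > 0"

(* Feasible set of the master problem whose feasibility cuts so far come from the triples in R. *)
definition bmp_feasible ::
  "'a set \<Rightarrow> 'a set \<Rightarrow> 'a vec2 \<Rightarrow> 'a vec2 \<Rightarrow> nat option \<Rightarrow> ('a \<Rightarrow> real) option \<Rightarrow>
   ('a vec2 \<times> 'a vec2 \<times> 'a vec2) set \<Rightarrow> ('a vec2 \<times> 'a vec2) set" where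
  "bmp_feasible N H w Q p U R = {(x, y).
     x \<in> assignments N H w p U \<and> y \<in> vehicle_numbers H \<and>
     (\<forall>(lam, mu, nu)\<in>R.
        (\<Sum>h\<in>H. \<Sum>k\<in>H. Q h k * lam h k * y h k) +
        (\<Sum>h\<in>H. \<Sum>i\<in>N. out_flow N w i * mu h i * x h i + (\<Sum>j\<in>N. w i j * nu h i * x h j)) \<le> 0)}"

end

theory Submission
  imports Defs
begin

text \<open>
  The choice of \<open>\<lambda>\<close> with a single nonzero entry matters only at the very end. For \<^emph>\<open>every\<close>
  \<open>\<lambda> \<le> 0\<close> the given formulas for \<open>\<mu>\<close> and \<open>\<nu>\<close> produce a point of the cone, and its objective value
  is the \<open>\<lambda>\<close>-weighted sum, over all arcs, of capacity minus flow.

  To see this, write \<open>a\<close> for the unique hub to which node \<open>i\<close> is assigned. The formulas then read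
  \<open>\<nu>\<^sub>k\<^sub>i = - \<lambda>\<^sub>a\<^sub>k\<close>, and \<open>\<mu>\<^sub>h\<^sub>i\<close> vanishes for \<open>h = a\<close> and equals \<open>\<Sum>\<^sub>k \<lambda>\<^sub>a\<^sub>k\<close> otherwise. For \<open>h = a\<close> the
  constraint at \<open>(h, k, i)\<close> is therefore tight. For \<open>h \<noteq> a\<close> its left-hand side is \<open>\<lambda>\<^sub>h\<^sub>k\<close> plus the row
  sum of \<open>\<lambda>\<close> at \<open>a\<close> with the entry at \<open>k\<close> removed, a sum of nonpositive numbers
  (\<open>aggregated_multipliers_in_cone\<close>). In the objective the \<open>\<mu>\<close>-part disappears, because \<open>x\<^sub>h\<^sub>i\<close>
  and \<open>\<mu>\<^sub>h\<^sub>i\<close> are never both nonzero; the \<open>\<nu>\<close>-part collects, with weight \<open>- \<lambda>\<^sub>h\<^sub>k\<close>, the flow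
  that originates at nodes of hub \<open>h\<close> and ends at nodes of hub \<open>k\<close>
  (\<open>dsp_objective_aggregated\<close>).

  Concentrating \<open>\<lambda>\<close> on one violated arc, with value \<open>- \<Gamma>\<close>, makes the objective \<open>\<Gamma>\<close> times the
  violation of that arc, which is positive.
\<close>

lemma assignment_hub:
  assumes "finite H" and "x \<in> assignments N H w p U" and "i \<in> N"
  obtains a where "a \<in> H" and "\<forall>h\<in>H. x h i = of_bool (h = a)"
proof -
  have bin: "\<forall>h\<in>H. x h i \<in> {0, 1}" and total: "(\<Sum>h\<in>H. x h i) = 1"
    using assms by (auto simp: assignments_def)
  have "\<exists>a\<in>H. x a i \<noteq> 0"
    using total by (metis sum.neutral zero_neq_one)
  then obtain a where a: "a \<in> H" "x a i = 1"
    using bin by auto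
  have "(\<Sum>h\<in>H - {a}. x h i) = 0"
    using total a \<open>finite H\<close> by (simp add: sum.remove)
  moreover have "\<forall>h\<in>H - {a}. x h i \<ge> 0"
    using bin by fastforce
  ultimately have "\<forall>h\<in>H - {a}. x h i = 0"
    using \<open>finite H\<close> sum_nonneg_eq_0_iff[of "H - {a}" "\<lambda>h. x h i"] by blast
  with a show thesis
    using that by auto
qed

text \<open>
  Weighting by the assignment of a node only selects the row of that node's hub, which turns the
  definitions of \<open>\<mu>\<close> and \<open>\<nu>\<close> into the explicit values used below.
\<close>

lemma aggregated_multipliers_at_hub:
  fixes lam x :: "'a vec2"
  assumes "finite H" and "a \<in> H" and hub: "\<forall>h\<in>H. x h i = of_bool (h = a)"
  shows "(\<Sum>h\<in>H. lam h k * x h i) = lam a k"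
    and "(\<Sum>h\<in>H. \<Sum>k\<in>H. lam h k * x h i) = (\<Sum>k\<in>H. lam a k)"
proof -
  have "(\<Sum>h\<in>H. f h * x h i) = f a" for f
  proof -
    have "(\<Sum>h\<in>H. f h * x h i) = (\<Sum>h\<in>H. if h = a then f h else 0)"
      by (intro sum.cong) (use hub in auto)
    then show ?thesis
      using assms by simp
  qed
  from this[of "\<lambda>h. lam h k"] this[of "\<lambda>h. \<Sum>k\<in>H. lam h k"]
  show "(\<Sum>h\<in>H. lam h k * x h i) = lam a k"
    and "(\<Sum>h\<in>H. \<Sum>k\<in>H. lam h k * x h i) = (\<Sum>k\<in>H. lam a k)"
    by (simp_all add: sum_distrib_right)
qed

lemma aggregated_multipliers_in_cone:
  assumes "finite H" and x: "x \<in> assignments N H w p U"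
    and nonpos: "\<forall>h\<in>H. \<forall>k\<in>H. lam h k \<le> 0"
    and mu: "\<forall>h\<in>H. \<forall>i\<in>N. mu h i = (\<Sum>h'\<in>H. \<Sum>k\<in>H. lam h' k * x h' i) - (\<Sum>k\<in>H. lam h k * x h i)"
    and nu: "\<forall>k\<in>H. \<forall>i\<in>N. nu k i = - (\<Sum>h\<in>H. lam h k * x h i)"
  shows "(lam, mu, nu) \<in> dsp_cone N H"
proof -
  have "lam h k + mu h i + nu k i \<le> 0" if h: "h \<in> H" and k: "k \<in> H" and i: "i \<in> N" for h k i
  proof -
    obtain a where a: "a \<in> H" and hub: "\<forall>h\<in>H. x h i = of_bool (h = a)"
      using assignment_hub[OF \<open>finite H\<close> x i] .
    have nu_i: "nu k i = - lam a k"
      using nu k i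
        aggregated_multipliers_at_hub(1)[where x = x and i = i, OF \<open>finite H\<close> a hub]
      by simp
    have mu_i: "mu h i = (\<Sum>k\<in>H. lam a k) - (\<Sum>k\<in>H. lam h k * of_bool (h = a))"
      using mu h i hub
        aggregated_multipliers_at_hub(2)[where x = x and i = i, OF \<open>finite H\<close> a hub]
      by simp
    show ?thesis
    proof (cases "h = a")
      case True
      then show ?thesis
        using nu_i mu_i by simp
    next
      case False
      have "(\<Sum>k'\<in>H - {k}. lam a k') \<le> 0"
        using nonpos a by (intro sum_nonpos) auto
      moreover have "lam h k + mu h i + nu k i = lam h k + (\<Sum>k'\<in>H - {k}. lam a k')"
        using False nu_i mu_i k \<open>finite H\<close> by (simp add: sum.remove)
      ultimately show ?thesis
        using nonpos h k by fastforce
    qed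
  qed
  with nonpos show ?thesis
    by (simp add: dsp_cone_def)
qed

text \<open>
  The \<open>\<mu>\<close>-terms drop out by complementarity with \<open>x\<close>. In the \<open>\<nu>\<close>-terms, substituting
  \<open>\<nu>\<^sub>k\<^sub>i = - \<Sum>\<^sub>h \<lambda>\<^sub>h\<^sub>k x\<^sub>h\<^sub>i\<close> and exchanging the order of summation isolates the coefficient of each
  \<open>\<lambda>\<^sub>h\<^sub>k\<close>, which is the flow on the arc \<open>(h, k)\<close>.
\<close>

lemma dsp_objective_aggregated:
  assumes "finite H" and x: "x \<in> assignments N H w p U"
    and mu: "\<forall>h\<in>H. \<forall>i\<in>N. mu h i = (\<Sum>h'\<in>H. \<Sum>k\<in>H. lam h' k * x h' i) - (\<Sum>k\<in>H. lam h k * x h i)"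
    and nu: "\<forall>k\<in>H. \<forall>i\<in>N. nu k i = - (\<Sum>h\<in>H. lam h k * x h i)"
  shows "dsp_objective N H w Q x y (lam, mu, nu) =
    (\<Sum>h\<in>H. \<Sum>k\<in>H. lam h k * (Q h k * y h k - (\<Sum>i\<in>N. x h i * (\<Sum>j\<in>N. w i j * x k j))))"
proof -
  have complementary: "x h i * mu h i = 0" if h: "h \<in> H" and i: "i \<in> N" for h i
  proof -
    obtain a where a: "a \<in> H" and hub: "\<forall>h\<in>H. x h i = of_bool (h = a)"
      using assignment_hub[OF \<open>finite H\<close> x i] .
    have "mu h i = (\<Sum>k\<in>H. lam a k) - (\<Sum>k\<in>H. lam h k * of_bool (h = a))"
      using mu h i hub
        aggregated_multipliers_at_hub(2)[where x = x and i = i, OF \<open>finite H\<close> a hub]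
      by simp
    then show ?thesis
      using hub h by simp
  qed
  have "(\<Sum>k\<in>H. \<Sum>i\<in>N. out_flow N w i * x k i * mu k i + (\<Sum>j\<in>N. w i j * x k j * nu k i))
      = (\<Sum>k\<in>H. \<Sum>i\<in>N. \<Sum>h\<in>H. - (lam h k * (x h i * (\<Sum>j\<in>N. w i j * x k j))))"
  proof (intro sum.cong refl)
    fix k i assume k: "k \<in> H" and i: "i \<in> N"
    have "out_flow N w i * x k i * mu k i + (\<Sum>j\<in>N. w i j * x k j * nu k i)
        = nu k i * (\<Sum>j\<in>N. w i j * x k j)"
      using complementary[OF k i] by (auto simp: sum_distrib_left mult.commute)
    also have "\<dots> = (\<Sum>h\<in>H. - (lam h k * (x h i * (\<Sum>j\<in>N. w i j * x k j))))"
      using nu k i by (simp add: sum_distrib_right sum_negf mult.assoc)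
    finally show "out_flow N w i * x k i * mu k i + (\<Sum>j\<in>N. w i j * x k j * nu k i)
        = (\<Sum>h\<in>H. - (lam h k * (x h i * (\<Sum>j\<in>N. w i j * x k j))))" .
  qed
  also have "\<dots> = (\<Sum>k\<in>H. \<Sum>h\<in>H. \<Sum>i\<in>N. - (lam h k * (x h i * (\<Sum>j\<in>N. w i j * x k j))))"
    by (intro sum.cong refl sum.swap)
  also have "\<dots> = (\<Sum>h\<in>H. \<Sum>k\<in>H. \<Sum>i\<in>N. - (lam h k * (x h i * (\<Sum>j\<in>N. w i j * x k j))))"
    by (rule sum.swap)
  also have "\<dots> = (\<Sum>h\<in>H. \<Sum>k\<in>H. - (lam h k * (\<Sum>i\<in>N. x h i * (\<Sum>j\<in>N. w i j * x k j))))"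
    by (simp only: sum_negf sum_distrib_left[symmetric])
  finally show ?thesis
    unfolding dsp_objective_def
    by (simp add: sum_subtractf sum_negf right_diff_distrib mult.commute[of "lam _ _" "Q _ _ * y _ _"])
qed

theorem theorem1:
  fixes N H :: "'a set"
    and w Q :: "'a \<Rightarrow> 'a \<Rightarrow> real"
    and p :: "nat option" and U :: "('a \<Rightarrow> real) option"
    and R :: "('a vec2 \<times> 'a vec2 \<times> 'a vec2) set"
    and x y :: "'a \<Rightarrow> 'a \<Rightarrow> real"
    and hh kh :: 'a and \<Gamma> :: real
    and lam mu nu :: "'a \<Rightarrow> 'a \<Rightarrow> real"
  assumes "finite N" and "H \<subseteq> N"
    and "\<forall>i\<in>N. \<forall>j\<in>N. w i j \<ge> 0"
    and "\<forall>h\<in>H. \<forall>k\<in>H. Q h k > 0"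
    and "finite R" and "R \<subseteq> dsp_cone N H"
    and "(x, y) \<in> bmp_feasible N H w Q p U R"
    and "hh \<in> H" and "kh \<in> H"
    and "(\<Sum>i\<in>N. x hh i * (\<Sum>j\<in>N. w i j * x kh j)) > Q hh kh * y hh kh"
    and "\<Gamma> > 0"
    and "\<forall>h\<in>H. \<forall>k\<in>H. lam h k = (if h = hh \<and> k = kh then - \<Gamma> else 0)"
    and "\<forall>h\<in>H. \<forall>i\<in>N. mu h i = (\<Sum>h'\<in>H. \<Sum>k\<in>H. lam h' k * x h' i) - (\<Sum>k\<in>H. lam h k * x h i)"
    and "\<forall>k\<in>H. \<forall>i\<in>N. nu k i = - (\<Sum>h\<in>H. lam h k * x h i)"
  shows "dsp_unbounded_ray N H w Q x y (lam, mu, nu)"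
proof -
  have fin: "finite H"
    using \<open>finite N\<close> \<open>H \<subseteq> N\<close> finite_subset by blast
  have x: "x \<in> assignments N H w p U"
    using assms(7) by (simp add: bmp_feasible_def)
  let ?slack = "\<lambda>h k. Q h k * y h k - (\<Sum>i\<in>N. x h i * (\<Sum>j\<in>N. w i j * x k j))"
  have "\<forall>h\<in>H. \<forall>k\<in>H. lam h k \<le> 0"
    using assms(11,12) by simp
  then have cone: "(lam, mu, nu) \<in> dsp_cone N H"
    using aggregated_multipliers_in_cone[OF fin x] assms(13,14) by blast
  have "dsp_objective N H w Q x y (lam, mu, nu) = (\<Sum>h\<in>H. \<Sum>k\<in>H. lam h k * ?slack h k)"
    using dsp_objective_aggregated[OF fin x assms(13,14)] .
  also have "\<dots> = (\<Sum>h\<in>H. \<Sum>k\<in>H. if k = kh then (if h = hh then - \<Gamma> * ?slack h k else 0) else 0)"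
    using assms(12) by (intro sum.cong refl) auto
  also have "\<dots> = - \<Gamma> * ?slack hh kh"
    using fin \<open>hh \<in> H\<close> \<open>kh \<in> H\<close> by (simp add: sum.delta)
  also have "\<dots> > 0"
    using assms(10,11) by (simp add: mult_less_0_iff)
  finally show ?thesis
    using cone by (simp add: dsp_unbounded_ray_def)
qed

end
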